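(* Let $\mathsf{P}_\ast\subset\mathbb{R}^2$ be a compact, convex set whose boundary $\partial\mathsf{P}_\ast$ is a curve of class $\mathscr{C}^1$. Let $\varphi\in C^1(\mathbb{R}^2\times\mathbb{R}\times\mathbb{S}^1)$ be real-valued and suppose that $$\varphi(v_\beta',\omega_\beta',\vartheta)+\varphi(\overline{v}_\beta',\overline{\omega}_\beta',\overline{\vartheta})=\varphi(v,\omega,\vartheta)+\varphi(\overline{v},\overline{\omega},\overline{\vartheta})$$ for all $v,\overline{v}\in\mathbb{R}^2$, all $\omega,\overline{\omega}\in\mathbb{R}$ and all $\beta=(\psi,\vartheta,\overline{\vartheta})\in\mathbb{T}^3$, where $[v_\beta',\overline{v}_\beta',\omega_\beta',\overline{\omega}_\beta']=\sigma_\beta^\times[V]$ with $V=[v,\overline{v},\omega,\overline{\omega}]\in\mathbb{R}^6$, and $\sigma_\beta^\times$ is the non-canonical physical scattering map associated to $\mathsf{P}_\ast$. Then there exist $a\in C^1(\mathbb{S}^1)$, $b\in\mathbb{R}^2$ and $c\in\mathbb{R}$ such that $$\varphi(v,\omega,\vartheta)=a(\vartheta)+b\cdot v+c\left(m|v|^2+J\omega^2\right)$$ for all $v\in\mathbb{R}^2$, $\omega\in\mathbb{R}$ and $\vartheta\in\mathbb{S}^1$.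
   Context: $\mathbb{S}^1$ is identified with $\mathbb{R}/2\pi\mathbb{Z}$ (angles) and $\mathbb{T}^k=(\mathbb{S}^1)^k$. Vectors in $\mathbb{R}^6$ are written $V=[v,\overline{v},\omega,\overline{\omega}]=(v_1,v_2,\overline{v}_1,\overline{v}_2,\omega,\overline{\omega})$ with $v,\overline{v}\in\mathbb{R}^2$ and $\omega,\overline{\omega}\in\mathbb{R}$. The set $\mathsf{P}_\ast$ (the reference particle) has nonempty interior and its centre of mass is at the origin. Its mass and inertia are $m:=\int_{\mathsf{P}_\ast}dy>0$ and $J:=\int_{\mathsf{P}_\ast}|y|^2\,dy>0$. For $\theta\in\mathbb{S}^1$, $R(\theta)\in\mathrm{SO}(2)$ is the rotation matrix by angle $\theta$, and $e(\psi):=(\cos\psi,\sin\psi)$. For $\beta=(\psi,\vartheta,\overline{\vartheta})\in\mathbb{T}^3$ the distance of closest approach is $$d_\beta:=\inf\{d>0: R(\vartheta)\mathsf{P}_\ast\cap(R(\overline{\vartheta})\mathsf{P}_\ast+d\,e(\psi))=\varnothing\}>0.$$ Let $M:=\mathrm{diag}(\sqrt m,\sqrt m,\sqrt m,\sqrt m,\sqrt J,\sqrt J)$, $\widehat{E}_1:=\frac{1}{\sqrt2}(1,0,1,0,0,0)^T$, $\widehat{E}_2:=\frac{1}{\sqrt2}(0,1,0,1,0,0)^T$, and $$\widehat{E}_\beta:=\frac{1}{\sqrt{2md_\beta^2+8J}}\left(\sqrt m\,d_\beta\sin\psi,\,-\sqrt m\,d_\beta\cos\psi,\,-\sqrt m\,d_\beta\sin\psi,\,\sqrt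 m\,d_\beta\cos\psi,\,2\sqrt J,\,2\sqrt J\right)^T.$$ The non-canonical physical scattering map $\sigma_\beta^\times:\mathbb{R}^6\to\mathbb{R}^6$ is the linear map $$\sigma_\beta^\times[V]:=M^{-1}\left(2\widehat{E}_1\otimes\widehat{E}_1+2\widehat{E}_2\otimes\widehat{E}_2+2\widehat{E}_\beta\otimes\widehat{E}_\beta-I_6\right)MV,$$ where $(x\otimes y)_{ij}=x_iy_j$. *)

theory Defs
  imports "HOL-Analysis.Analysis"
begin

text \<open>
  Conventions. The circle \<open>\<S>\<^sup>1 = \<real>/2\<pi>\<int>\<close> is handled through representatives: angles are reals, and
  a function on \<open>X \<times> \<S>\<^sup>1\<close> is a function on \<open>X \<times> \<real>\<close> that is \<open>2\<pi>\<close>-periodic in the last argument.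
  As \<open>\<real> \<rightarrow> \<real>/2\<pi>\<int>\<close> is a local diffeomorphism, such a function is \<open>C\<^sup>1\<close> on the quotient
  iff it is \<open>C\<^sup>1\<close> on \<open>X \<times> \<real>\<close>. Barred quantities carry the suffix \<open>b\<close>.
\<close>

subsection \<open>Regularity\<close>

definition continuously_differentiable ::
    "('a::real_normed_vector \<Rightarrow> 'b::real_normed_vector) \<Rightarrow> bool" where
  "continuously_differentiable f \<longleftrightarrow>
     (\<exists>f'. (\<forall>x. (f has_derivative blinfun_apply (f' x)) (at x)) \<and> continuous_on UNIV f')"

text \<open>
  A simple closed curve with a regular \<open>C\<^sup>1\<close> parametrisation. The closed curve is parametrised by
  \<open>\<real>/\<int>\<close>, so that there is no exceptional base point; without nonvanishing speed a \<open>C\<^sup>1\<close>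
  parametrisation could have corners.
\<close>

definition C1_closed_curve :: "'a::real_normed_vector set \<Rightarrow> bool" where
  "C1_closed_curve S \<longleftrightarrow>
     (\<exists>\<gamma>. \<gamma> C1_differentiable_on UNIV \<and>
          (\<forall>t. vector_derivative \<gamma> (at t) \<noteq> 0) \<and>
          (\<forall>s t. \<gamma> s = \<gamma> t \<longleftrightarrow> s - t \<in> \<int>) \<and>
          range \<gamma> = S)"

subsection \<open>The reference particle\<close>

definition mass :: "(real^2) set \<Rightarrow> real" where
  "mass P = (LINT y:P|lborel. 1)"

definition inertia :: "(real^2) set \<Rightarrow> real" where
  "inertia P = (LINT y:P|lborel. (norm y)\<^sup>2)"

definition centre_of_mass :: "(real^2) set \<Rightarrow> real^2" where
  "centre_of_mass P = (1 / mass P) *\<^sub>R (LINT y:P|lborel. y)"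

definition rot :: "real \<Rightarrow> real^2^2" where
  "rot \<theta> = vector [vector [cos \<theta>, - sin \<theta>], vector [sin \<theta>, cos \<theta>]]"

definition unit_dir :: "real \<Rightarrow> real^2" where
  "unit_dir \<psi> = vector [cos \<psi>, sin \<psi>]"

definition closest_dist :: "(real^2) set \<Rightarrow> real \<Rightarrow> real \<Rightarrow> real \<Rightarrow> real" where
  "closest_dist P \<psi> \<theta> \<theta>b =
     Inf {d. d > 0 \<and>
             (\<lambda>y. rot \<theta> *v y) ` P \<inter> (\<lambda>y. rot \<theta>b *v y + d *\<^sub>R unit_dir \<psi>) ` P = {}}"

subsection \<open>The scattering map\<close>

definition phase_vec :: "real^2 \<Rightarrow> real^2 \<Rightarrow> real \<Rightarrow> real \<Rightarrow> real^6" where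
  "phase_vec v vb \<omega> \<omega>b = vector [v$1, v$2, vb$1, vb$2, \<omega>, \<omega>b]"

definition diag_matrix :: "real^'n \<Rightarrow> real^'n^'n" where
  "diag_matrix x = (\<chi> i j. if i = j then x$i else 0)"

definition outer_product :: "real^'m \<Rightarrow> real^'n \<Rightarrow> real^'n^'m" where
  "outer_product x y = (\<chi> i j. x$i * y$j)"

definition mass_matrix :: "(real^2) set \<Rightarrow> real^6^6" where
  "mass_matrix P =
     (let m = mass P; J = inertia P
      in diag_matrix (vector [sqrt m, sqrt m, sqrt m, sqrt m, sqrt J, sqrt J]))"

definition E1 :: "real^6" where
  "E1 = (1 / sqrt 2) *\<^sub>R vector [1, 0, 1, 0, 0, 0]"

definition E2 :: "real^6" where
  "E2 = (1 / sqrt 2) *\<^sub>R vector [0, 1, 0, 1, 0, 0]"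

definition Ebeta :: "(real^2) set \<Rightarrow> real \<Rightarrow> real \<Rightarrow> real \<Rightarrow> real^6" where
  "Ebeta P \<psi> \<theta> \<theta>b =
     (let m = mass P; J = inertia P; d = closest_dist P \<psi> \<theta> \<theta>b
      in (1 / sqrt (2 * m * d\<^sup>2 + 8 * J)) *\<^sub>R
           vector [sqrt m * d * sin \<psi>, - sqrt m * d * cos \<psi>,
                   - sqrt m * d * sin \<psi>, sqrt m * d * cos \<psi>,
                   2 * sqrt J, 2 * sqrt J])"

definition scattering :: "(real^2) set \<Rightarrow> real \<Rightarrow> real \<Rightarrow> real \<Rightarrow> real^6 \<Rightarrow> real^6" where
  "scattering P \<psi> \<theta> \<theta>b V =
     (let M = mass_matrix P; E\<beta> = Ebeta P \<psi> \<theta> \<theta>b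
      in (matrix_inv M **
          (2 *\<^sub>R outer_product E1 E1 + 2 *\<^sub>R outer_product E2 E2 +
           2 *\<^sub>R outer_product E\<beta> E\<beta> - mat 1) ** M) *v V)"

end

theory Submission
  imports Defs
begin

text \<open>
  For fixed angles, put \<open>p = d (sin \<psi>, -cos \<psi>)\<close>. After subtracting the conserved centre-of-mass velocity
  and flipping the sign of \<open>\<omega> - \<omega>b\<close>, the scattering map is the half-turn about the axis
  \<open>(\<surd>m p, 2 \<surd>J)\<close> in the space of the vectors \<open>(\<surd>m (v - vb), \<surd>J (\<omega> + \<omega>b))\<close>. Take equal angles
  \<open>\<theta> = \<theta>b\<close>. Then \<open>d\<close> stays between two positive constants, so the axes accumulate, and differentiating
  along the accumulating axes shows that \<open>\<phi>(v, \<omega>) + \<phi>(vb, \<omega>b)\<close> is annihilated by one infinitesimal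
  rotation. Conjugating with the half-turns produces all the others. Hence the vector
  \<open>(\<nabla>\<phi>(v, \<omega>) - \<nabla>\<phi>(vb, \<omega>b), \<partial>\<phi>(v, \<omega>) + \<partial>\<phi>(vb, \<omega>b))\<close> of velocity gradients and
  \<open>\<omega>\<close>-derivatives is parallel to \<open>(m (v - vb), J (\<omega> + \<omega>b))\<close>, which forces the affine-quadratic form.
  Its coefficients do not depend on the angle because a collision in direction \<open>e(\<psi>)\<close> merely exchanges
  the velocities \<open>e(\<psi>)\<close> and \<open>0\<close>.
\<close>

section \<open>Planar vectors and limits of secant directions\<close>

definition cross2 :: "real^2 \<Rightarrow> real^2 \<Rightarrow> real" where
  "cross2 x y = x$1 * y$2 - x$2 * y$1"

lemma inner_real2: "x \<bullet> y = x$1 * y$1 + x$2 * y$2" for x y :: "real^2"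
  by (simp add: inner_vec_def sum_2)

lemma norm_unit_dir: "norm (unit_dir \<psi>) = 1"
  by (simp add: norm_eq_1 inner_real2 unit_dir_def flip: power2_eq_square)

text \<open>\<open>p\<close> is an accumulation point of \<open>S\<close> and \<open>u\<close> a
  limit of normalised secants from \<open>p\<close>. The point \<open>p\<close> may lie outside
  \<open>S\<close>, but \<open>H p = c\<close> by continuity, so the increments of \<open>H\<close>
  along these secants vanish and differentiability at \<open>p\<close> gives
  \<open>H' u = 0\<close>.\<close>

lemma secant_directions_limit:
  fixes S :: "('a::euclidean_space) set"
  assumes "infinite S" "bounded S"
  obtains p u where "u \<noteq> 0"
    "\<And>H H' c. (H has_derivative H') (at p) \<Longrightarrow> (\<And>q. q \<in> S \<Longrightarrow> H q = (c::real)) \<Longrightarrow> H' u = 0"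
proof -
  obtain p where "p islimpt S"
    using assms bounded_infinite_imp_islimpt[of S S] by blast
  then obtain q where q: "\<And>n. q n \<in> S - {p}" and ql: "q \<longlonglongrightarrow> p"
    unfolding islimpt_sequential by blast
  define e where "e n = (q n - p) /\<^sub>R norm (q n - p)" for n
  have "e n \<in> sphere 0 1" for n
    using q[of n] by (simp add: e_def)
  then obtain u r where u: "u \<in> sphere 0 1" and r: "strict_mono r" and el: "(e \<circ> r) \<longlonglongrightarrow> u"
    using compact_sphere[of "0::'a" 1] unfolding compact_def by blast
  show thesis
  proof
    show "u \<noteq> 0" using u by auto
    fix H :: "'a \<Rightarrow> real" and H' c
    assume H: "(H has_derivative H') (at p)" and c: "\<And>q. q \<in> S \<Longrightarrow> H q = c"
    interpret bounded_linear H' using H by (rule has_derivative_bounded_linear)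
    have qr: "(q \<circ> r) \<longlonglongrightarrow> p" using ql r by (rule LIMSEQ_subseq_LIMSEQ)
    have at: "filterlim (q \<circ> r) (at p) sequentially"
      using qr q by (auto simp: filterlim_at)
    have "(\<lambda>n. H ((q \<circ> r) n)) \<longlonglongrightarrow> H p"
      using has_derivative_continuous[OF H] qr by (rule isCont_tendsto_compose)
    then have Hp: "H p = c"
      using c q by (auto simp: LIMSEQ_const_iff)
    have "((\<lambda>y. (H y - H p - H' (y - p)) /\<^sub>R norm (y - p)) \<longlongrightarrow> 0) (at p)"
      using H unfolding has_derivative_at_within by simp
    from filterlim_compose[OF this at]
    have "(\<lambda>n. - H' ((e \<circ> r) n)) \<longlonglongrightarrow> 0"
      using c q Hp by (simp add: e_def scaleR o_def)
    moreover have "(\<lambda>n. - H' ((e \<circ> r) n)) \<longlonglongrightarrow> - H' u"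
      by (intro tendsto_intros tendsto el)
    ultimately show "H' u = 0" using LIMSEQ_unique by fastforce
  qed
qed

text \<open>The coefficient of the orthogonal projection of \<open>(\<surd>m w, \<surd>J s)\<close>
  onto the axis \<open>(\<surd>m q, 2 \<surd>J)\<close>.\<close>

definition impulse :: "real \<Rightarrow> real \<Rightarrow> real^2 \<Rightarrow> real^2 \<Rightarrow> real \<Rightarrow> real" where
  "impulse m J q w s = (m * (q \<bullet> w) + 2 * J * s) / (m * (q \<bullet> q) + 4 * J)"

section \<open>Collision invariants at a fixed common angle\<close>

locale collision_invariant =
  fixes m J :: real and f :: "(real^2) \<times> real \<Rightarrow> real"
    and g :: "(real^2) \<times> real \<Rightarrow> real^2" and h :: "(real^2) \<times> real \<Rightarrow> real"
  assumes m_pos: "0 < m" and J_pos: "0 < J"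
    and deriv: "\<And>y. (f has_derivative (\<lambda>z. g y \<bullet> fst z + h y * snd z)) (at y)"
begin

definition invariant_under :: "real^2 \<Rightarrow> bool" where
  "invariant_under q \<longleftrightarrow> (\<forall>v vb \<omega> \<omega>b.
     f (vb + impulse m J q (v - vb) (\<omega> + \<omega>b) *\<^sub>R q, 2 * impulse m J q (v - vb) (\<omega> + \<omega>b) - \<omega>) +
     f (v - impulse m J q (v - vb) (\<omega> + \<omega>b) *\<^sub>R q, 2 * impulse m J q (v - vb) (\<omega> + \<omega>b) - \<omega>b) =
     f (v, \<omega>) + f (vb, \<omega>b))"

text \<open>Together with \<open>gw\<close> this is a gradient in the relative variables:
  \<open>gv \<bullet> x + gw * t\<close> is the derivative of
  \<open>f (v, \<omega>) + f (vb, \<omega>b)\<close> when \<open>v\<close> moves by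
  \<open>x\<close>, \<open>vb\<close> by \<open>- x\<close> and both spins by
  \<open>t\<close>.\<close>

definition gv :: "real^2 \<Rightarrow> real \<Rightarrow> real^2 \<Rightarrow> real \<Rightarrow> real^2" where
  "gv v \<omega> vb \<omega>b = g (v, \<omega>) - g (vb, \<omega>b)"

definition gw :: "real^2 \<Rightarrow> real \<Rightarrow> real^2 \<Rightarrow> real \<Rightarrow> real" where
  "gw v \<omega> vb \<omega>b = h (v, \<omega>) + h (vb, \<omega>b)"

text \<open>
  Up to constant factors, \<open>mixed\<close> (rotated by a quarter-turn) and \<open>planar\<close> are the components of the
  angular momentum \<open>x \<times> \<nabla>\<close> in the three-dimensional space of the header.
\<close>

definition mixed :: "real^2 \<Rightarrow> real \<Rightarrow> real^2 \<Rightarrow> real \<Rightarrow> real^2" where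
  "mixed v \<omega> vb \<omega>b = (J * (\<omega> + \<omega>b)) *\<^sub>R gv v \<omega> vb \<omega>b - (m * gw v \<omega> vb \<omega>b) *\<^sub>R (v - vb)"

definition planar :: "real^2 \<Rightarrow> real \<Rightarrow> real^2 \<Rightarrow> real \<Rightarrow> real" where
  "planar v \<omega> vb \<omega>b = cross2 (v - vb) (gv v \<omega> vb \<omega>b)"

section \<open>Action of the half-turns on states, gradients and angular momentum\<close>

lemma denom_pos: "0 < m * (q \<bullet> q) + 4 * J"
  using m_pos J_pos by (simp add: add_nonneg_pos)

lemma impulse_scaled: "impulse m J q w s * (m * (q \<bullet> q) + 4 * J) = m * (q \<bullet> w) + 2 * J * s"
  using denom_pos[of q] by (simp add: impulse_def)

lemma impulse_add_scaled:
  "impulse m J q (w + (2 * e) *\<^sub>R x) (s + 2 * e * t) = impulse m J q w s + 2 * e * impulse m J q x t"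
  by (simp add: impulse_def inner_add_right distrib_left add_divide_distrib mult_ac)

text \<open>A half-turn preserves the component along its own axis.\<close>

lemma impulse_reflected:
  "impulse m J q ((2 * impulse m J q w s) *\<^sub>R q - w) (4 * impulse m J q w s - s) = impulse m J q w s"
proof -
  have "m * (q \<bullet> ((2 * impulse m J q w s) *\<^sub>R q - w)) + 2 * J * (4 * impulse m J q w s - s)
    = impulse m J q w s * (m * (q \<bullet> q) + 4 * J)"
    using impulse_scaled[of q w s] by (simp add: inner_diff_right algebra_simps)
  then show ?thesis
    using denom_pos[of q] by (simp add: impulse_def[of m J q "_ - w"])
qed

text \<open>The collision is linear, so displacing the incoming state by \<open>(x, t)\<close>
  displaces the outgoing one by the half-turn of \<open>(x, t)\<close>. The claim is the
  conservation law differentiated at \<open>e = 0\<close>.\<close>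

lemma gradient_transform:
  assumes "invariant_under q" and l: "l = impulse m J q (v - vb) (\<omega> + \<omega>b)"
  defines "v' \<equiv> vb + l *\<^sub>R q" and "\<omega>' \<equiv> 2 * l - \<omega>" and "vb' \<equiv> v - l *\<^sub>R q" and "\<omega>b' \<equiv> 2 * l - \<omega>b"
  shows "gv v \<omega> vb \<omega>b \<bullet> x + gw v \<omega> vb \<omega>b * t =
    gv v' \<omega>' vb' \<omega>b' \<bullet> ((2 * impulse m J q x t) *\<^sub>R q - x) + gw v' \<omega>' vb' \<omega>b' * (4 * impulse m J q x t - t)"
proof -
  define \<mu> where "\<mu> = impulse m J q x t"
  have d: "((\<lambda>e. f (y + e *\<^sub>R a, z + e * b)) has_derivative (\<lambda>e. g (y, z) \<bullet> (e *\<^sub>R a) + h (y, z) * (e * b))) (at 0)"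
    for y a z b
  proof -
    have "((\<lambda>e. (y + e *\<^sub>R a, z + e * b)) has_derivative (\<lambda>e. (e *\<^sub>R a, e * b))) (at 0)"
      by (auto intro!: derivative_eq_intros)
    from has_derivative_compose[OF this deriv] show ?thesis by simp
  qed
  have eq: "f (v' + e *\<^sub>R ((2 * \<mu>) *\<^sub>R q - x), \<omega>' + e * (4 * \<mu> - t)) +
      f (vb' + e *\<^sub>R (x - (2 * \<mu>) *\<^sub>R q), \<omega>b' + e * (4 * \<mu> - t))
    = f (v + e *\<^sub>R x, \<omega> + e * t) + f (vb + e *\<^sub>R (- x), \<omega>b + e * t)" for e
  proof -
    have i: "impulse m J q ((v + e *\<^sub>R x) - (vb + e *\<^sub>R (- x))) ((\<omega> + e * t) + (\<omega>b + e * t)) = l + 2 * e * \<mu>"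
      using impulse_add_scaled[of q "v - vb" e x "\<omega> + \<omega>b" t]
      by (simp add: \<mu>_def l algebra_simps flip: scaleR_2)
    show ?thesis
      using assms(1)[unfolded invariant_under_def, rule_format,
          of "vb + e *\<^sub>R (- x)" "v + e *\<^sub>R x" "\<omega> + e * t" "\<omega>b + e * t"]
      unfolding i v'_def vb'_def \<omega>'_def \<omega>b'_def by (simp add: algebra_simps)
  qed
  let ?L = "\<lambda>e. f (v' + e *\<^sub>R ((2 * \<mu>) *\<^sub>R q - x), \<omega>' + e * (4 * \<mu> - t)) +
      f (vb' + e *\<^sub>R (x - (2 * \<mu>) *\<^sub>R q), \<omega>b' + e * (4 * \<mu> - t))"
  have "(?L has_derivative (\<lambda>e. (g (v', \<omega>') \<bullet> (e *\<^sub>R ((2 * \<mu>) *\<^sub>R q - x)) + h (v', \<omega>') * (e * (4 * \<mu> - t)))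
     + (g (vb', \<omega>b') \<bullet> (e *\<^sub>R (x - (2 * \<mu>) *\<^sub>R q)) + h (vb', \<omega>b') * (e * (4 * \<mu> - t))))) (at 0)"
    by (intro has_derivative_add d)
  moreover have "(?L has_derivative (\<lambda>e. (g (v, \<omega>) \<bullet> (e *\<^sub>R x) + h (v, \<omega>) * (e * t))
     + (g (vb, \<omega>b) \<bullet> (e *\<^sub>R (- x)) + h (vb, \<omega>b) * (e * t)))) (at 0)"
    unfolding eq by (intro has_derivative_add d)
  ultimately have "(\<lambda>e. (g (v', \<omega>') \<bullet> (e *\<^sub>R ((2 * \<mu>) *\<^sub>R q - x)) + h (v', \<omega>') * (e * (4 * \<mu> - t)))
     + (g (vb', \<omega>b') \<bullet> (e *\<^sub>R (x - (2 * \<mu>) *\<^sub>R q)) + h (vb', \<omega>b') * (e * (4 * \<mu> - t))))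
     = (\<lambda>e. (g (v, \<omega>) \<bullet> (e *\<^sub>R x) + h (v, \<omega>) * (e * t))
     + (g (vb, \<omega>b) \<bullet> (e *\<^sub>R (- x)) + h (vb, \<omega>b) * (e * t)))"
    by (rule has_derivative_unique)
  from fun_cong[OF this, of 1] show ?thesis
    by (simp add: gv_def gw_def \<mu>_def algebra_simps)
qed

text \<open>For a fixed incoming state the outgoing sum is constant as \<open>q\<close> runs through
  \<open>S\<close>, so its derivative at \<open>p\<close> along \<open>u\<close> vanishes. As
  \<open>p\<close> and \<open>u\<close> are chosen before the state, the resulting relation has the
  same coefficients at all states.\<close>

lemma generator_of_secants:
  assumes "infinite S" "bounded S" "\<And>q. q \<in> S \<Longrightarrow> invariant_under q"
  obtains p u where "u \<noteq> 0"
    "\<And>v \<omega> vb \<omega>b. m * cross2 p u * planar v \<omega> vb \<omega>b + 2 * (u \<bullet> mixed v \<omega> vb \<omega>b) = 0"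
proof -
  obtain p u where u0: "u \<noteq> 0" and
    u: "\<And>H H' c. (H has_derivative H') (at p) \<Longrightarrow> (\<And>q. q \<in> S \<Longrightarrow> H q = (c::real)) \<Longrightarrow> H' u = 0"
    using secant_directions_limit[OF assms(1,2)] by metis
  show thesis
  proof
    show "u \<noteq> 0" by (rule u0)
    fix v vb :: "real^2" and \<omega> \<omega>b :: real
    define w s where "w = v - vb" and "s = \<omega> + \<omega>b"
    define N where "N = m * (p \<bullet> p) + 4 * J"
    define l where "l = impulse m J p w s"
    have N: "N > 0" unfolding N_def by (rule denom_pos)
    have lN: "l * N = m * (p \<bullet> w) + 2 * J * s" unfolding l_def N_def by (rule impulse_scaled)
    \<comment> \<open>The incoming state is the image of the given one under the collision with
      \<open>p\<close>. That collision is an involution, so \<open>q = p\<close> leads back to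
      \<open>(v, \<omega>)\<close> and \<open>(vb, \<omega>b)\<close>, where the gradient is
      wanted.\<close>
    define y z yb zb where "y = vb + l *\<^sub>R p" and "z = 2 * l - \<omega>"
      and "yb = v - l *\<^sub>R p" and "zb = 2 * l - \<omega>b"
    define L where "L q = impulse m J q (y - yb) (z + zb)" for q
    have Lp: "L p = l"
      using impulse_reflected[of p w s]
      by (simp add: L_def l_def y_def yb_def z_def zb_def w_def s_def algebra_simps flip: scaleR_2)
    define L' where "L' x = (m * (x \<bullet> (y - yb)) - 2 * l * m * (p \<bullet> x)) / N" for x
    have L': "(L has_derivative L') (at p)"
    proof -
      have "(L has_derivative (\<lambda>x. ((m * (x \<bullet> (y - yb))) * N - (m * (p \<bullet> (y - yb)) + 2 * J * (z + zb))
          * (m * (p \<bullet> x + x \<bullet> p))) / (N * N))) (at p)"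
        unfolding L_def[abs_def] impulse_def N_def
        using denom_pos[of p] by (auto intro!: derivative_eq_intros)
      moreover have "m * (p \<bullet> (y - yb)) + 2 * J * (z + zb) = l * N"
        using impulse_scaled[of p "y - yb" "z + zb"] Lp unfolding L_def N_def by simp
      ultimately have "(L has_derivative (\<lambda>x. ((m * (x \<bullet> (y - yb))) * N - (l * N) * (m * (p \<bullet> x + x \<bullet> p))) / (N * N))) (at p)"
        by (simp only:)
      then show ?thesis
        using N unfolding L'_def[abs_def]
        by (elim has_derivative_eq_rhs) (auto simp: fun_eq_iff inner_commute field_simps simp del: distrib_left_numeral)
    qed
    let ?H = "\<lambda>q. f (yb + L q *\<^sub>R q, 2 * L q - z) + f (y - L q *\<^sub>R q, 2 * L q - zb)"
    have a: "((\<lambda>q. (yb + L q *\<^sub>R q, 2 * L q - z)) has_derivative (\<lambda>x. (l *\<^sub>R x + L' x *\<^sub>R p, 2 * L' x))) (at p)"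
      by (auto intro!: derivative_eq_intros L' simp: Lp)
    have b: "((\<lambda>q. (y - L q *\<^sub>R q, 2 * L q - zb)) has_derivative (\<lambda>x. (- (l *\<^sub>R x + L' x *\<^sub>R p), 2 * L' x))) (at p)"
      by (auto intro!: derivative_eq_intros L' simp: Lp)
    have e: "yb + l *\<^sub>R p = v" "2 * l - z = \<omega>" "y - l *\<^sub>R p = vb" "2 * l - zb = \<omega>b"
      by (auto simp: y_def z_def yb_def zb_def)
    have "(?H has_derivative (\<lambda>x. (g (v, \<omega>) \<bullet> (l *\<^sub>R x + L' x *\<^sub>R p) + h (v, \<omega>) * (2 * L' x))
        + (g (vb, \<omega>b) \<bullet> (- (l *\<^sub>R x + L' x *\<^sub>R p)) + h (vb, \<omega>b) * (2 * L' x)))) (at p)"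
      using has_derivative_add[OF has_derivative_compose[OF a deriv] has_derivative_compose[OF b deriv]]
      by (simp add: Lp e)
    moreover have "?H q = f (y, z) + f (yb, zb)" if "q \<in> S" for q
      using assms(3)[OF that] unfolding invariant_under_def L_def by blast
    ultimately have "(g (v, \<omega>) \<bullet> (l *\<^sub>R u + L' u *\<^sub>R p) + h (v, \<omega>) * (2 * L' u))
        + (g (vb, \<omega>b) \<bullet> (- (l *\<^sub>R u + L' u *\<^sub>R p)) + h (vb, \<omega>b) * (2 * L' u)) = 0"
      by (rule u)
    then have *: "gv v \<omega> vb \<omega>b \<bullet> (l *\<^sub>R u + L' u *\<^sub>R p) + gw v \<omega> vb \<omega>b * (2 * L' u) = 0"
      by (simp add: gv_def gw_def algebra_simps)
    have "L' u * N = - m * (u \<bullet> w)"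
    proof -
      have "y - yb = (2 * l) *\<^sub>R p - w"
        by (simp add: y_def yb_def w_def algebra_simps flip: scaleR_2)
      then show ?thesis
        using N by (simp only: L'_def) (simp add: inner_diff_right inner_commute[of u p] right_diff_distrib)
    qed
    moreover have "gv v \<omega> vb \<omega>b \<bullet> ((l * N) *\<^sub>R u + (L' u * N) *\<^sub>R p) + gw v \<omega> vb \<omega>b * (2 * (L' u * N)) = 0"
      using arg_cong[OF *, of "\<lambda>c. c * N"] by (simp add: algebra_simps inner_add_right)
    ultimately have "gv v \<omega> vb \<omega>b \<bullet> ((m * (p \<bullet> w) + 2 * J * s) *\<^sub>R u + (- m * (u \<bullet> w)) *\<^sub>R p)
       + gw v \<omega> vb \<omega>b * (2 * (- m * (u \<bullet> w))) = 0"
      by (simp add: lN)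
    \<comment> \<open>With \<open>G\<close> for \<open>gv\<close>, this uses the Binet-Cauchy
      identity \<open>(p \<bullet> w) (u \<bullet> G) - (u \<bullet> w) (p \<bullet> G) = cross2 p u
      * cross2 w G\<close>.\<close>
    then show "m * cross2 p u * planar v \<omega> vb \<omega>b + 2 * (u \<bullet> mixed v \<omega> vb \<omega>b) = 0"
      unfolding planar_def mixed_def cross2_def w_def s_def by (simp add: inner_real2 algebra_simps)
  qed
qed


text \<open>
  With \<open>n\<close> the axis encoded by \<open>(x, \<beta>)\<close>, \<open>a\<close> that of the half-turn \<open>R\<close> and \<open>c\<close> the angular momentum,
  \<open>n \<bullet> c = 0 = n \<bullet> R c\<close> and \<open>R c = 2 (a \<bullet> c) a / (a \<bullet> a) - c\<close> give \<open>(a \<bullet> n) (a \<bullet> c) = 0\<close>.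
\<close>

lemma half_turn_conjugation:
  assumes q: "invariant_under q"
    and zero: "\<And>v \<omega> vb \<omega>b. x \<bullet> mixed v \<omega> vb \<omega>b + \<beta> * planar v \<omega> vb \<omega>b = 0"
  shows "(m * cross2 x q + 2 * \<beta>) * (2 * J * planar v \<omega> vb \<omega>b - cross2 q (mixed v \<omega> vb \<omega>b)) = 0"
proof -
  define w s where "w = v - vb" and "s = \<omega> + \<omega>b"
  define N where "N = m * (q \<bullet> q) + 4 * J"
  define l where "l = impulse m J q w s"
  define v' \<omega>' vb' \<omega>b' where "v' = vb + l *\<^sub>R q" and "\<omega>' = 2 * l - \<omega>"
    and "vb' = v - l *\<^sub>R q" and "\<omega>b' = 2 * l - \<omega>b"
  define G' \<gamma>' G \<gamma> where "G' = gv v' \<omega>' vb' \<omega>b'" and "\<gamma>' = gw v' \<omega>' vb' \<omega>b'"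
    and "G = gv v \<omega> vb \<omega>b" and "\<gamma> = gw v \<omega> vb \<omega>b"
  \<comment> \<open>The projection coefficient of the gradient
    \<open>(G' / \<surd>m, \<gamma>' / \<surd>J)\<close> onto the axis of \<open>q\<close>, as
    \<open>l\<close> is for the state. By \<open>\<kappa>N\<close> below, it has the same value
    before the collision.\<close>
  define \<kappa> where "\<kappa> = (G' \<bullet> q + 2 * \<gamma>') / N"
  have N: "N > 0" unfolding N_def by (rule denom_pos)
  have lN: "l * N = m * (q \<bullet> w) + 2 * J * s" unfolding l_def N_def by (rule impulse_scaled)
  have \<kappa>: "\<kappa> * N = G' \<bullet> q + 2 * \<gamma>'" using N by (simp add: \<kappa>_def)
  have tr: "G \<bullet> z + \<gamma> * t = G' \<bullet> ((2 * impulse m J q z t) *\<^sub>R q - z) + \<gamma>' * (4 * impulse m J q z t - t)" for z t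
    using gradient_transform[OF q, of l v vb \<omega> \<omega>b z t]
    unfolding G'_def \<gamma>'_def G_def \<gamma>_def v'_def \<omega>'_def vb'_def \<omega>b'_def l_def w_def s_def by simp
  have tr': "G \<bullet> z + \<gamma> * t = - (G' \<bullet> z) - \<gamma>' * t + 2 * \<kappa> * (m * (q \<bullet> z) + 2 * J * t)" for z t
  proof -
    have "2 * (impulse m J q z t * (G' \<bullet> q + 2 * \<gamma>')) = 2 * \<kappa> * (m * (q \<bullet> z) + 2 * J * t)"
      unfolding \<kappa>[symmetric] impulse_scaled[symmetric] N_def by simp
    then show ?thesis unfolding tr by (simp add: inner_diff_right algebra_simps)
  qed
  \<comment> \<open>Comparing coefficients in \<open>tr'\<close> shows that the gradient undergoes
    the same half-turn as the state.\<close>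
  have G: "G' = (2 * m * \<kappa>) *\<^sub>R q - G"
  proof (subst vector_eq_ldot[symmetric], intro allI)
    fix z
    show "z \<bullet> G' = z \<bullet> ((2 * m * \<kappa>) *\<^sub>R q - G)"
      using tr'[of z 0] by (simp add: inner_diff_right inner_commute)
  qed
  have \<gamma>: "\<gamma>' = 4 * J * \<kappa> - \<gamma>" using tr'[of 0 1] by simp
  have \<kappa>N: "\<kappa> * N = G \<bullet> q + 2 * \<gamma>"
    using tr'[of q 2] \<kappa> by (simp add: N_def algebra_simps)
  have w': "v' - vb' = (2 * l) *\<^sub>R q - w"
    by (simp add: v'_def vb'_def w_def algebra_simps flip: scaleR_2)
  have s': "\<omega>' + \<omega>b' = 4 * l - s"
    by (simp add: \<omega>'_def \<omega>b'_def s_def)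
  \<comment> \<open>The angular momentum, a cross product of state and gradient, is half-turned with
    them. Since \<open>zero\<close> applies before and after the collision, only the terms with
    \<open>l\<close> and \<open>\<kappa>\<close> survive.\<close>
  have X': "x \<bullet> mixed v' \<omega>' vb' \<omega>b' + \<beta> * planar v' \<omega>' vb' \<omega>b'
    = (x \<bullet> mixed v \<omega> vb \<omega>b + \<beta> * planar v \<omega> vb \<omega>b)
      - l * (4 * J * (x \<bullet> G) - 2 * m * \<gamma> * (x \<bullet> q) + 2 * \<beta> * cross2 q G)
      + \<kappa> * (4 * J * m * (x \<bullet> w) - 2 * J * m * s * (x \<bullet> q) - 2 * m * \<beta> * cross2 w q)"
    unfolding mixed_def planar_def w' s' G'_def[symmetric] \<gamma>'_def[symmetric] G_def[symmetric] \<gamma>_def[symmetric]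
      w_def[symmetric] s_def[symmetric] G \<gamma> cross2_def inner_real2
    by (simp add: algebra_simps)
  then have "l * (4 * J * (x \<bullet> G) - 2 * m * \<gamma> * (x \<bullet> q) + 2 * \<beta> * cross2 q G)
      = \<kappa> * (4 * J * m * (x \<bullet> w) - 2 * J * m * s * (x \<bullet> q) - 2 * m * \<beta> * cross2 w q)"
    unfolding zero by simp
  then have *: "(l * N) * (4 * J * (x \<bullet> G) - 2 * m * \<gamma> * (x \<bullet> q) + 2 * \<beta> * cross2 q G)
      = (\<kappa> * N) * (4 * J * m * (x \<bullet> w) - 2 * J * m * s * (x \<bullet> q) - 2 * m * \<beta> * cross2 w q)"
    by simp
  \<comment> \<open>The left side is \<open>2 (a \<bullet> n) (a \<bullet> c)\<close>; the identity
    is polynomial once \<open>l * N\<close> and \<open>\<kappa> * N\<close> are expanded.\<close>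
  have "2 * ((m * cross2 x q + 2 * \<beta>) * (2 * J * planar v \<omega> vb \<omega>b - cross2 q (mixed v \<omega> vb \<omega>b)))
    = 2 * N * (x \<bullet> mixed v \<omega> vb \<omega>b + \<beta> * planar v \<omega> vb \<omega>b)
      - (l * N) * (4 * J * (x \<bullet> G) - 2 * m * \<gamma> * (x \<bullet> q) + 2 * \<beta> * cross2 q G)
      + (\<kappa> * N) * (4 * J * m * (x \<bullet> w) - 2 * J * m * s * (x \<bullet> q) - 2 * m * \<beta> * cross2 w q)"
    unfolding mixed_def planar_def G_def[symmetric] \<gamma>_def[symmetric] w_def[symmetric] s_def[symmetric]
      lN \<kappa>N
    unfolding N_def cross2_def inner_real2
    by (simp add: algebra_simps)
  then show ?thesis using * zero[of v \<omega> vb \<omega>b] by simp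
qed

section \<open>From vanishing angular momentum to the affine-quadratic form\<close>

text \<open>Setting \<open>v = vb\<close> removes \<open>\<omega>\<close> from \<open>g\<close>;
  setting \<open>\<omega>b = - \<omega>\<close> removes \<open>v\<close> from \<open>h\<close> and
  makes it odd. The variables then separate: \<open>g\<close> is affine in \<open>v\<close> and
  \<open>h\<close> linear in \<open>\<omega>\<close>, with a common constant.\<close>

lemma affine_quadratic:
  assumes K: "\<And>v \<omega> vb \<omega>b. mixed v \<omega> vb \<omega>b = 0"
  shows "\<exists>b c. \<forall>v \<omega>. f (v, \<omega>) = f (0, 0) + b \<bullet> v + c * (m * (norm v)\<^sup>2 + J * \<omega>\<^sup>2)"
proof -
  have g_indep: "g (v, \<omega>) = g (v, 0)" for v \<omega>
  proof -
    have e: "g (v, x) = g (v, y)" if "x + y \<noteq> 0" for x y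
      using K[of v x v y] that J_pos by (simp add: mixed_def gv_def)
    show ?thesis using e[of \<omega> 0] by (cases "\<omega> = 0") auto
  qed
  have h_odd: "h (v, \<omega>) = - h (vb, - \<omega>)" if "v \<noteq> vb" for v vb \<omega>
    using K[of v \<omega> vb "- \<omega>"] that m_pos by (simp add: mixed_def gw_def)
  have h_indep: "h (v, \<omega>) = h (0, \<omega>)" for v \<omega>
  proof -
    \<comment> \<open>\<open>h_odd\<close> needs distinct velocities, so \<open>v\<close> and
      \<open>0\<close> are compared through a third one.\<close>
    have "\<exists>y. y \<notin> {v, 0::real^2}"
      by (rule ex_new_if_finite) (auto simp: infinite_UNIV_char_0)
    then obtain y where "y \<notin> {v, 0}" by blast
    then have "v \<noteq> y" "0 \<noteq> y" by auto
    from h_odd[OF this(1)] h_odd[OF this(2)] show ?thesis by (simp only:)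
  qed
  have h0: "h (v, 0) = 0" for v
    using h_odd[of "axis 1 1" 0 0] h_indep[of v 0] h_indep[of "axis 1 1" 0] by simp
  define c where "c = h (0, 1) / J"
  have g_diff: "(J * \<omega>) *\<^sub>R (g (v, 0) - g (vb, 0)) = (m * h (0, \<omega>)) *\<^sub>R (v - vb)" for v vb \<omega>
    using K[of v \<omega> vb 0] g_indep[of v \<omega>] h_indep[of v \<omega>] h0
    by (simp add: mixed_def gv_def gw_def)
  have g_form: "g (v, \<omega>) = g (0, 0) + (c * m) *\<^sub>R v" for v \<omega>
  proof -
    have "J *\<^sub>R (g (v, 0) - g (0, 0)) = J *\<^sub>R ((c * m) *\<^sub>R v)"
      using g_diff[of 1 v 0] J_pos by (simp add: c_def mult.commute)
    then show ?thesis
      using J_pos g_indep[of v \<omega>] by (simp only: scaleR_cancel_left) (simp add: algebra_simps)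
  qed
  have h_form: "h (v, \<omega>) = c * J * \<omega>" for v \<omega>
  proof -
    have "(m * (J * c * \<omega>)) *\<^sub>R axis 1 1 = (m * h (0, \<omega>)) *\<^sub>R (axis 1 1 :: real^2)"
      using g_diff[of \<omega> "axis 1 1" 0] g_form[of "axis 1 1" 0] by (simp add: mult_ac)
    then have "m * (J * c * \<omega>) = m * h (0, \<omega>)"
      by (simp only: scaleR_cancel_right) simp
    then show ?thesis using m_pos h_indep[of v \<omega>] by (simp add: mult_ac)
  qed
  \<comment> \<open>\<open>c\<close> is the slope of the gradient, so the potential carries
    \<open>c / 2\<close>.\<close>
  let ?d = "\<lambda>z. f z - (g (0, 0) \<bullet> fst z + c / 2 * (m * (fst z \<bullet> fst z) + J * (snd z * snd z)))"
  have "(?d has_derivative (\<lambda>z. 0)) (at y)" for y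
  proof -
    have "(?d has_derivative (\<lambda>z. (g y \<bullet> fst z + h y * snd z) - (g (0, 0) \<bullet> fst z
        + c / 2 * (m * (fst y \<bullet> fst z + fst z \<bullet> fst y) + J * (snd y * snd z + snd z * snd y))))) (at y)"
      by (intro has_derivative_diff deriv) (auto intro!: derivative_eq_intros)
    then show ?thesis
      using g_form[of "fst y" "snd y"] h_form[of "fst y" "snd y"]
      by (elim has_derivative_eq_rhs) (auto simp: fun_eq_iff algebra_simps inner_commute)
  qed
  then obtain k where k: "\<And>z. ?d z = k"
    using has_derivative_zero_constant[of UNIV ?d] by auto
  have "f (v, \<omega>) = f (0, 0) + g (0, 0) \<bullet> v + c / 2 * (m * (norm v)\<^sup>2 + J * \<omega>\<^sup>2)" for v \<omega>
    using k[of "(v, \<omega>)"] k[of "(0, 0)"] by (simp add: power2_norm_eq_inner power2_eq_square[of \<omega>])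
  then show ?thesis by blast
qed


text \<open>The accumulating axes give one relation for the angular momentum. Conjugation turns it
  into the vanishing of the component along some axis, then spreads this from axis to axis; three
  non-coplanar axes suffice.\<close>

lemma affine_quadratic_of_directions:
  assumes r: "0 < r" and s: "\<And>\<psi>. r \<le> s \<psi>" "\<And>\<psi>. s \<psi> \<le> B"
    and inv: "\<And>\<psi>. invariant_under (s \<psi> *\<^sub>R unit_dir \<psi>)"
  shows "\<exists>b c. \<forall>v \<omega>. f (v, \<omega>) = f (0, 0) + b \<bullet> v + c * (m * (norm v)\<^sup>2 + J * \<omega>\<^sup>2)"
proof -
  have spos: "0 < s \<psi>" for \<psi> using r s(1)[of \<psi>] by linarith
  define Q where "Q \<psi> = s \<psi> *\<^sub>R unit_dir \<psi>" for \<psi>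
  have invQ: "invariant_under (Q \<psi>)" for \<psi> using inv by (simp add: Q_def)
  have Q1: "Q \<psi> $ 1 = s \<psi> * cos \<psi>" and Q2: "Q \<psi> $ 2 = s \<psi> * sin \<psi>" for \<psi>
    by (simp_all add: Q_def unit_dir_def)
  have normQ: "norm (Q \<psi>) = s \<psi>" for \<psi>
  proof -
    show ?thesis using spos[of \<psi>] by (simp add: Q_def norm_unit_dir)
  qed
  \<comment> \<open>Equal points have equal norms, hence equal \<open>s\<close>, and the cosine is
    injective on the half circle.\<close>
  have "inj_on Q {0..pi}"
  proof (rule inj_onI)
    fix a b assume ab: "a \<in> {0..pi}" "b \<in> {0..pi}" "Q a = Q b"
    then have "s a = s b" using normQ by metis
    then have "cos a = cos b" using ab(3) Q1[of a] Q1[of b] spos[of b] by auto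
    then show "a = b" using ab cos_inj_pi by auto
  qed
  then have "infinite (Q ` {0..pi})" by (simp add: finite_image_iff infinite_Icc)
  then have "infinite (range Q)" using finite_subset[of "Q ` {0..pi}" "range Q"] by auto
  moreover have "bounded (range Q)"
    using s(2) normQ by (auto simp: bounded_iff)
  ultimately obtain p u where u0: "u \<noteq> 0" and
    u: "\<And>v \<omega> vb \<omega>b. m * cross2 p u * planar v \<omega> vb \<omega>b + 2 * (u \<bullet> mixed v \<omega> vb \<omega>b) = 0"
    using generator_of_secants[of "range Q"] invQ by (metis rangeE)
  \<comment> \<open>The component of the angular momentum along the axis of \<open>q\<close>
    vanishes.\<close>
  define annihilated where "annihilated q \<longleftrightarrow>
    (\<forall>v \<omega> vb \<omega>b. 2 * J * planar v \<omega> vb \<omega>b = cross2 q (mixed v \<omega> vb \<omega>b))" for q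
  have step: "annihilated q" if "invariant_under q"
    "\<And>v \<omega> vb \<omega>b. x \<bullet> mixed v \<omega> vb \<omega>b + \<beta> * planar v \<omega> vb \<omega>b = 0" "m * cross2 x q + 2 * \<beta> \<noteq> 0" for x \<beta> q
    using half_turn_conjugation[OF that(1,2)] that(3) by (simp add: annihilated_def)
  have chain: "annihilated q" if "annihilated q'" "invariant_under q" "0 \<le> q' \<bullet> q" for q q'
  \<comment> \<open>This vector and \<open>2 * J\<close> encode the axis of \<open>q'\<close>, so
    the factor that must not vanish is the inner product of two axes,
    \<open>m * (q' \<bullet> q) + 4 * J\<close>.\<close>
  proof (rule step[OF that(2), of "vector [q' $ 2, - q' $ 1]" "2 * J"])
    show "(vector [q' $ 2, - q' $ 1]) \<bullet> mixed v \<omega> vb \<omega>b + 2 * J * planar v \<omega> vb \<omega>b = 0" for v \<omega> vb \<omega>b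
      using that(1) by (simp add: annihilated_def cross2_def inner_real2)
    have "m * cross2 (vector [q' $ 2, - q' $ 1]) q + 2 * (2 * J) = m * (q' \<bullet> q) + 4 * J"
      by (simp add: cross2_def inner_real2 algebra_simps)
    also have "\<dots> > 0" using m_pos J_pos that(3) by (simp add: add_nonneg_pos)
    finally show "m * cross2 (vector [q' $ 2, - q' $ 1]) q + 2 * (2 * J) \<noteq> 0" by simp
  qed
  \<comment> \<open>Otherwise \<open>cross2 u (Q \<psi>)\<close> would not depend on
    \<open>\<psi>\<close>. Comparing opposite directions, where \<open>s\<close> is positive, would
    then give \<open>u = 0\<close>.\<close>
  have "\<exists>\<psi>. m * cross2 (2 *\<^sub>R u) (Q \<psi>) + 2 * (m * cross2 p u) \<noteq> 0"
  proof (rule ccontr)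
    assume "\<not> ?thesis"
    then have "m * cross2 (2 *\<^sub>R u) (Q \<psi>) + 2 * (m * cross2 p u) = 0" for \<psi>
      by blast
    then have "(2 * m) * (cross2 u (Q \<psi>) + cross2 p u) = 0" for \<psi>
      by (simp add: cross2_def algebra_simps)
    then have e: "cross2 u (Q \<psi>) + cross2 p u = 0" for \<psi>
      using m_pos by simp
    have "u $ 2 * (s 0 + s pi) = 0"
      using e[of 0] e[of pi] by (simp add: cross2_def Q1 Q2 algebra_simps)
    moreover have "u $ 1 * (s (pi / 2) + s (- (pi / 2))) = 0"
      using e[of "pi / 2"] e[of "- (pi / 2)"] by (simp add: cross2_def Q1 Q2 algebra_simps)
    ultimately have "u $ 1 = 0" "u $ 2 = 0"
      using spos[of 0] spos[of pi] spos[of "pi / 2"] spos[of "- (pi / 2)"] by auto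
    then show False using u0 by (simp add: vec_eq_iff forall_2)
  qed
  then obtain \<psi>1 where \<psi>1: "m * cross2 (2 *\<^sub>R u) (Q \<psi>1) + 2 * (m * cross2 p u) \<noteq> 0" by blast
  have a1: "annihilated (Q \<psi>1)"
    by (rule step[OF invQ _ \<psi>1]) (use u in \<open>simp add: algebra_simps\<close>)
  \<comment> \<open>One of the directions \<open>0\<close> and \<open>pi\<close> makes a non-obtuse
    angle with \<open>\<psi>1\<close>. From it both perpendicular directions are reached, and from
    these the direction \<open>0\<close>.\<close>
  have "0 \<le> Q \<psi>1 \<bullet> Q 0 \<or> 0 \<le> Q \<psi>1 \<bullet> Q pi"
    using spos[of 0] spos[of pi] by (auto simp: inner_real2 Q1[of 0] Q2[of 0] Q1[of pi] Q2[of pi] zero_le_mult_iff mult_le_0_iff)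
  then obtain a where a: "a = 0 \<or> a = pi" "annihilated (Q a)"
    using chain[OF a1 invQ] by blast
  have up: "annihilated (Q (pi / 2))" and down: "annihilated (Q (- (pi / 2)))"
    using a(1) by (auto intro!: chain[OF a(2) invQ] simp: inner_real2 Q1 Q2)
  have right: "annihilated (Q 0)"
    by (rule chain[OF up invQ]) (simp add: inner_real2 Q1 Q2)
  have "mixed v \<omega> vb \<omega>b = 0" for v \<omega> vb \<omega>b
  proof -
    let ?K = "mixed v \<omega> vb \<omega>b"
    have e: "2 * J * planar v \<omega> vb \<omega>b = - s (pi / 2) * ?K $ 1"
      "2 * J * planar v \<omega> vb \<omega>b = s (- (pi / 2)) * ?K $ 1"
      "2 * J * planar v \<omega> vb \<omega>b = s 0 * ?K $ 2"
      using up down right by (simp_all add: annihilated_def cross2_def Q1 Q2)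
    have "(s (pi / 2) + s (- (pi / 2))) * ?K $ 1 = 0"
      using e(1,2) by (simp add: algebra_simps)
    then have "?K $ 1 = 0" using spos[of "pi / 2"] spos[of "- (pi / 2)"] by auto
    moreover from this have "?K $ 2 = 0" using e(1,3) spos[of 0] by simp
    ultimately show ?thesis by (simp add: vec_eq_iff forall_2)
  qed
  then show ?thesis by (rule affine_quadratic)
qed

end

section \<open>The scattering map in coordinates\<close>

lemma exhaust_6: "x = 1 \<or> x = 2 \<or> x = 3 \<or> x = 4 \<or> x = 5 \<or> x = 6" for x :: 6
proof (induct x)
  case (of_int z)
  then have "z = 0 \<or> z = 1 \<or> z = 2 \<or> z = 3 \<or> z = 4 \<or> z = 5" by fastforce
  then show ?case by auto
qed

lemma UNIV_6: "UNIV = {1, 2, 3, 4, 5, 6 :: 6}"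
  using exhaust_6 by auto

lemma sum_6: "sum f (UNIV :: 6 set) = f 1 + f 2 + f 3 + f 4 + f 5 + f 6"
  unfolding UNIV_6 by (simp add: ac_simps)

lemma forall_6: "(\<forall>i::6. P i) \<longleftrightarrow> P 1 \<and> P 2 \<and> P 3 \<and> P 4 \<and> P 5 \<and> P 6"
  by (metis exhaust_6)

lemma vector_6:
  "(vector [a, b, c, d, e, f] :: 'a::zero^6) $ 1 = a"
  "(vector [a, b, c, d, e, f] :: 'a^6) $ 2 = b"
  "(vector [a, b, c, d, e, f] :: 'a^6) $ 3 = c"
  "(vector [a, b, c, d, e, f] :: 'a^6) $ 4 = d"
  "(vector [a, b, c, d, e, f] :: 'a^6) $ 5 = e"
  "(vector [a, b, c, d, e, f] :: 'a^6) $ 6 = f"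
  unfolding vector_def by simp_all

lemma diag_matrix_vector_mult: "(diag_matrix x *v y) $ i = x $ i * y $ i"
  by (simp add: diag_matrix_def matrix_vector_mult_def if_distrib[of "\<lambda>c. c * _"] cong: if_cong)

lemma outer_product_vector_mult: "outer_product x y *v z = (y \<bullet> z) *\<^sub>R x"
  by (simp add: vec_eq_iff outer_product_def matrix_vector_mult_def inner_vec_def sum_distrib_left mult_ac)

lemma invertible_diag_matrix:
  assumes "\<And>i. x $ i \<noteq> 0"
  shows "invertible (diag_matrix x)"
proof -
  have "diag_matrix x ** diag_matrix (\<chi> i. 1 / x $ i) = mat 1"
    by (rule matrix_eq[THEN iffD2])
      (simp add: vec_eq_iff diag_matrix_vector_mult assms flip: matrix_vector_mul_assoc)
  then show ?thesis by (metis invertible_right_inverse)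
qed

text \<open>In mass-weighted coordinates the first two projections and \<open>- mat 1\<close>
  exchange the velocities and flip both spins. The third adds \<open>l\<close> times
  \<open>(\<surd>m q, - \<surd>m q, 2 \<surd>J, 2 \<surd>J)\<close>, where \<open>q\<close> has
  direction \<open>(sin \<psi>, - cos \<psi>)\<close>, hence the shift by
  \<open>pi / 2\<close>.\<close>

lemma scattering_phase_vec:
  fixes P :: "(real^2) set" and v vb :: "real^2"
  defines "m \<equiv> mass P" and "J \<equiv> inertia P"
  assumes m: "0 < m" and J: "0 < J"
    and q: "q = closest_dist P \<psi> \<theta> \<theta>b *\<^sub>R unit_dir (\<psi> - pi / 2)"
    and l: "l = impulse m J q (v - vb) (\<omega> + \<omega>b)"
  shows "scattering P \<psi> \<theta> \<theta>b (phase_vec v vb \<omega> \<omega>b)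
    = phase_vec (vb + l *\<^sub>R q) (v - l *\<^sub>R q) (2 * l - \<omega>) (2 * l - \<omega>b)"
proof -
  define d where "d = closest_dist P \<psi> \<theta> \<theta>b"
  define N where "N = 2 * m * d\<^sup>2 + 8 * J"
  define M where "M = mass_matrix P"
  define X :: "real^6" where "X = vector [sqrt m * d * sin \<psi>, - sqrt m * d * cos \<psi>,
    - sqrt m * d * sin \<psi>, sqrt m * d * cos \<psi>, 2 * sqrt J, 2 * sqrt J]"
  define U where "U = M *v phase_vec v vb \<omega> \<omega>b"
  have N: "N > 0" unfolding N_def using m J by (simp add: add_nonneg_pos)
  have qc: "q $ 1 = d * sin \<psi>" "q $ 2 = - d * cos \<psi>"
    by (simp_all add: q d_def unit_dir_def cos_diff sin_diff)
  have M: "M = diag_matrix (vector [sqrt m, sqrt m, sqrt m, sqrt m, sqrt J, sqrt J])"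
    by (simp add: M_def mass_matrix_def m_def J_def Let_def)
  have "\<forall>i. (vector [sqrt m, sqrt m, sqrt m, sqrt m, sqrt J, sqrt J] :: real^6) $ i \<noteq> 0"
    using m J by (simp add: forall_6 vector_6)
  then have "invertible M" unfolding M by (intro invertible_diag_matrix) blast
  then have inv: "matrix_inv M ** M = mat 1"
    unfolding invertible_def matrix_inv_def by (rule someI2_ex) simp
  have mm: "sqrt m * sqrt m = m" "sqrt J * sqrt J = J" using m J by simp_all
  have Uc: "U $ 1 = sqrt m * v $ 1" "U $ 2 = sqrt m * v $ 2" "U $ 3 = sqrt m * vb $ 1"
    "U $ 4 = sqrt m * vb $ 2" "U $ 5 = sqrt J * \<omega>" "U $ 6 = sqrt J * \<omega>b"
    by (simp_all add: U_def M diag_matrix_vector_mult phase_vec_def vector_6)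
  have 1: "(2 * (E1 \<bullet> U)) *\<^sub>R E1 = (U $ 1 + U $ 3) *\<^sub>R vector [1, 0, 1, 0, 0, 0]"
    by (simp add: E1_def inner_vec_def[of "vector _"] sum_6 vector_6)
  have 2: "(2 * (E2 \<bullet> U)) *\<^sub>R E2 = (U $ 2 + U $ 4) *\<^sub>R vector [0, 1, 0, 1, 0, 0]"
    by (simp add: E2_def inner_vec_def[of "vector _"] sum_6 vector_6)
  have EX: "Ebeta P \<psi> \<theta> \<theta>b = (1 / sqrt N) *\<^sub>R X"
    by (simp add: Ebeta_def X_def N_def d_def m_def J_def Let_def)
  have "X \<bullet> U = (sqrt m * sqrt m) * (q \<bullet> (v - vb)) + 2 * (sqrt J * sqrt J) * (\<omega> + \<omega>b)"
    unfolding inner_vec_def[of X] sum_6 inner_real2 qc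
    by (simp add: X_def vector_6 Uc algebra_simps del: real_sqrt_mult_self)
  \<comment> \<open>\<open>N\<close> is the squared norm of \<open>X\<close>, twice the denominator
    of \<open>impulse\<close>; this absorbs the 2 before the projection.\<close>
  moreover have "N = 2 * (m * (q \<bullet> q) + 4 * J)"
  proof -
    have "q \<bullet> q = d\<^sup>2 * ((sin \<psi>)\<^sup>2 + (cos \<psi>)\<^sup>2)"
      unfolding inner_real2 qc
      by (simp add: power2_eq_square algebra_simps del: sin_cos_squared_add3)
    then show ?thesis by (simp add: N_def)
  qed
  ultimately have "2 * (X \<bullet> U) / N = l"
    by (simp only: l impulse_def mm) (rule mult_divide_mult_cancel_left, simp)
  then have 3: "(2 * (Ebeta P \<psi> \<theta> \<theta>b \<bullet> U)) *\<^sub>R Ebeta P \<psi> \<theta> \<theta>b = l *\<^sub>R X"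
    using N by (simp add: EX)
  have "(2 *\<^sub>R outer_product E1 E1 + 2 *\<^sub>R outer_product E2 E2 +
      2 *\<^sub>R outer_product (Ebeta P \<psi> \<theta> \<theta>b) (Ebeta P \<psi> \<theta> \<theta>b) - mat 1) *v U
    = (2 * (E1 \<bullet> U)) *\<^sub>R E1 + (2 * (E2 \<bullet> U)) *\<^sub>R E2 + (2 * (Ebeta P \<psi> \<theta> \<theta>b \<bullet> U)) *\<^sub>R Ebeta P \<psi> \<theta> \<theta>b - U"
    by (simp add: matrix_vector_mult_add_rdistrib matrix_vector_mult_diff_rdistrib
        outer_product_vector_mult flip: scaleR_matrix_vector_assoc)
  also have "\<dots> = M *v phase_vec (vb + l *\<^sub>R q) (v - l *\<^sub>R q) (2 * l - \<omega>) (2 * l - \<omega>b)"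
    unfolding 1 2 3
    by (simp add: vec_eq_iff forall_6 vector_6 Uc X_def M diag_matrix_vector_mult phase_vec_def qc algebra_simps)
  finally show ?thesis
    unfolding scattering_def Let_def M_def[symmetric] U_def
    by (simp add: inv flip: matrix_vector_mul_assoc) (simp add: inv matrix_vector_mul_assoc)
qed

section \<open>Bounds for the distance of closest approach at equal angles\<close>

lemma rot_unit_dir: "rot \<theta> *v unit_dir \<psi> = unit_dir (\<theta> + \<psi>)"
  by (simp add: vec_eq_iff forall_2 rot_def unit_dir_def matrix_vector_mult_def sum_2 cos_add sin_add)

lemma norm_rot: "norm (rot \<theta> *v y) = norm y"
proof -
  have "(rot \<theta> *v y) \<bullet> (rot \<theta> *v y) = (y \<bullet> y) * ((sin \<theta>)\<^sup>2 + (cos \<theta>)\<^sup>2)"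
    unfolding inner_real2
    by (simp add: rot_def matrix_vector_mult_def sum_2 power2_eq_square algebra_simps del: sin_cos_squared_add3)
  then show ?thesis by (simp add: norm_eq_sqrt_inner)
qed

text \<open>At equal angles the particles are translates of each other. A shift shorter than the
  radius of an inner ball keeps its centre inside \<open>P\<close>; a shift beyond the diameter
  separates them.\<close>

lemma closest_dist_same_angle_bounds:
  assumes "bounded P" and "interior P \<noteq> {}"
  obtains r B where "0 < r"
    "\<And>\<psi> \<theta>. r \<le> closest_dist P \<psi> \<theta> \<theta>" "\<And>\<psi> \<theta>. closest_dist P \<psi> \<theta> \<theta> \<le> B"
proof -
  obtain x r where r: "0 < r" "ball x r \<subseteq> P"
    using assms(2) by (meson all_not_in_conv mem_interior)
  obtain B where B: "\<And>y. y \<in> P \<Longrightarrow> norm y \<le> B"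
    using assms(1) by (auto simp: bounded_iff)
  define A where "A \<psi> \<theta> = {d. d > 0 \<and>
    (\<lambda>y. rot \<theta> *v y) ` P \<inter> (\<lambda>y. rot \<theta> *v y + d *\<^sub>R unit_dir \<psi>) ` P = {}}" for \<psi> \<theta>
  have "x \<in> P" using r by auto
  then have B0: "0 \<le> B" using B[of x] norm_ge_zero[of x] by linarith
  \<comment> \<open>\<open>2 * B\<close> bounds the diameter, and \<open>+ 1\<close> makes the shift
    strictly larger. Membership also shows that the infimum is over a nonempty set.\<close>
  have far: "2 * B + 1 \<in> A \<psi> \<theta>" for \<psi> \<theta>
  proof -
    have False if "y \<in> P" "z \<in> P" "rot \<theta> *v y = rot \<theta> *v z + (2 * B + 1) *\<^sub>R unit_dir \<psi>" for y z
    proof -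
      have "rot \<theta> *v (y - z) = (2 * B + 1) *\<^sub>R unit_dir \<psi>"
        using that(3) by (simp add: matrix_vector_mult_diff_distrib)
      from arg_cong[OF this, of norm] have "norm (y - z) = 2 * B + 1"
        using B0 by (simp add: norm_rot norm_unit_dir)
      then show False using norm_triangle_ineq4[of y z] B[OF that(1)] B[OF that(2)] by linarith
    qed
    then show ?thesis using B0 unfolding A_def by auto
  qed
  have near: "r \<le> d" if "d \<in> A \<psi> \<theta>" for d \<psi> \<theta>
  proof (rule ccontr)
    assume "\<not> r \<le> d"
    then have d: "0 < d" "d < r" using that by (auto simp: A_def)
    \<comment> \<open>Undoing the common rotation turns the direction \<open>\<psi>\<close> into
      \<open>\<psi> - \<theta>\<close>.\<close>
    have "x + d *\<^sub>R unit_dir (\<psi> - \<theta>) \<in> P"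
      using d r by (intro subsetD[OF r(2)]) (simp add: dist_norm norm_unit_dir)
    moreover have "rot \<theta> *v (x + d *\<^sub>R unit_dir (\<psi> - \<theta>)) = rot \<theta> *v x + d *\<^sub>R unit_dir \<psi>"
      by (simp add: matrix_vector_right_distrib matrix_vector_mult_scaleR rot_unit_dir)
    ultimately have "rot \<theta> *v x + d *\<^sub>R unit_dir \<psi> \<in>
        (\<lambda>y. rot \<theta> *v y) ` P \<inter> (\<lambda>y. rot \<theta> *v y + d *\<^sub>R unit_dir \<psi>) ` P"
      using \<open>x \<in> P\<close> by (metis IntI image_eqI)
    then show False using that by (auto simp: A_def)
  qed
  have cd: "closest_dist P \<psi> \<theta> \<theta> = Inf (A \<psi> \<theta>)" for \<psi> \<theta>
    by (simp add: closest_dist_def A_def)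
  show thesis
  proof
    show "0 < r" by (rule r)
    show "r \<le> closest_dist P \<psi> \<theta> \<theta>" for \<psi> \<theta>
      unfolding cd using far[of \<psi> \<theta>] near by (intro cInf_greatest) auto
    show "closest_dist P \<psi> \<theta> \<theta> \<le> 2 * B + 1" for \<psi> \<theta>
      unfolding cd using far near by (intro cInf_lower bdd_belowI) auto
  qed
qed

section \<open>Positivity of mass and inertia\<close>

text \<open>Strict positivity is waived at the origin to admit the integrand of the inertia. A zero
  integral would make the nonempty open set \<open>interior P\<close> negligible.\<close>

lemma set_integral_pos:
  fixes f :: "'a::euclidean_space \<Rightarrow> real"
  assumes "compact P" "interior P \<noteq> {}" "continuous_on P f" "\<And>y. y \<in> P \<Longrightarrow> y \<noteq> 0 \<Longrightarrow> 0 < f y"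
    "0 \<in> P \<Longrightarrow> 0 \<le> f 0"
  shows "0 < (LINT y:P|lborel. f y)"
proof -
  have int: "set_integrable lborel P f"
    unfolding set_integrable_def using assms(1,3) by (rule borel_integrable_compact)
  have nn: "0 \<le> indicator P y * f y" for y
    using assms(4)[of y] assms(5) by (cases "y = 0") (auto simp: indicator_def less_imp_le)
  have "(LINT y:P|lborel. f y) \<noteq> 0"
  proof
    assume "(LINT y:P|lborel. f y) = 0"
    then have "AE y in lborel. indicator P y * f y = 0"
      using integral_nonneg_eq_0_iff_AE[of lborel "\<lambda>y. indicator P y * f y"] int nn
      by (simp add: set_lebesgue_integral_def set_integrable_def)
    moreover have "AE y in lborel. y \<noteq> (0::'a)" by (rule AE_lborel_singleton)
    ultimately have "AE y in lborel. y \<notin> interior P"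
    proof eventually_elim
      case (elim y)
      then show ?case using assms(4)[of y] interior_subset[of P] by auto
    qed
    then have "AE y in lebesgue. y \<notin> interior P"
      by (rule AE_completion)
    then have "negligible (interior P)"
      by (simp add: negligible_iff_null_sets AE_iff_null_sets)
    then show False
      using open_not_negligible[of "interior P"] assms(2) by simp
  qed
  moreover have "0 \<le> (LINT y:P|lborel. f y)"
    unfolding set_lebesgue_integral_def using nn by (intro Bochner_Integration.integral_nonneg) simp
  ultimately show ?thesis by simp
qed

section \<open>Joining the angles\<close>

lemma pair_gradient:
  fixes f :: "'a::euclidean_space \<times> real \<Rightarrow> real"
  assumes "(f has_derivative D) (at y)"
  shows "\<exists>g h. (f has_derivative (\<lambda>z. g \<bullet> fst z + h * snd z)) (at y)"
proof -
  have "linear D" using assms by (rule has_derivative_linear)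
  then have "D z = fst (adjoint D 1) \<bullet> fst z + snd (adjoint D 1) * snd z" for z
    using adjoint_works[of D z 1] by (simp add: inner_prod_def inner_commute mult.commute)
  then have "D = (\<lambda>z. fst (adjoint D 1) \<bullet> fst z + snd (adjoint D 1) * snd z)" by blast
  with assms have "(f has_derivative (\<lambda>z. fst (adjoint D 1) \<bullet> fst z + snd (adjoint D 1) * snd z)) (at y)"
    by (rule has_derivative_eq_rhs)
  then show ?thesis by blast
qed

theorem theorem1p10:
  fixes P :: "(real^2) set" and \<phi> :: "(real^2) \<times> real \<times> real \<Rightarrow> real"
  assumes "compact P" and "convex P" and "interior P \<noteq> {}" and "centre_of_mass P = 0"
    and "C1_closed_curve (frontier P)"
    and "continuously_differentiable \<phi>"
    and "\<And>v \<omega> \<theta>. \<phi> (v, \<omega>, \<theta> + 2 * pi) = \<phi> (v, \<omega>, \<theta>)"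
    and "\<And>v vb \<omega> \<omega>b \<psi> \<theta> \<theta>b v' vb' \<omega>' \<omega>b'.
           phase_vec v' vb' \<omega>' \<omega>b' = scattering P \<psi> \<theta> \<theta>b (phase_vec v vb \<omega> \<omega>b) \<Longrightarrow>
           \<phi> (v', \<omega>', \<theta>) + \<phi> (vb', \<omega>b', \<theta>b) = \<phi> (v, \<omega>, \<theta>) + \<phi> (vb, \<omega>b, \<theta>b)"
  shows "\<exists>(a :: real \<Rightarrow> real) (b :: real^2) (c :: real).
           continuously_differentiable a \<and> (\<forall>\<theta>. a (\<theta> + 2 * pi) = a \<theta>) \<and>
           (\<forall>v \<omega> \<theta>. \<phi> (v, \<omega>, \<theta>) =
              a \<theta> + b \<bullet> v + c * (mass P * (norm v)\<^sup>2 + inertia P * \<omega>\<^sup>2))"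
proof -
  define m J where "m = mass P" and "J = inertia P"
  have m: "0 < m"
    unfolding m_def mass_def using assms(1,3) by (intro set_integral_pos) auto
  have J: "0 < J"
    unfolding J_def inertia_def using assms(1,3)
    by (intro set_integral_pos) (auto intro!: continuous_intros)
  have balance: "\<phi> (vb + l *\<^sub>R q, 2 * l - \<omega>, \<theta>) + \<phi> (v - l *\<^sub>R q, 2 * l - \<omega>b, \<theta>b)
      = \<phi> (v, \<omega>, \<theta>) + \<phi> (vb, \<omega>b, \<theta>b)"
    if "q = closest_dist P \<psi> \<theta> \<theta>b *\<^sub>R unit_dir (\<psi> - pi / 2)" "l = impulse m J q (v - vb) (\<omega> + \<omega>b)"
    for v vb \<omega> \<omega>b \<psi> \<theta> \<theta>b q l
    by (rule assms(8)[of _ _ _ _ \<psi>], rule scattering_phase_vec[symmetric])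
      (use m J that in \<open>simp_all add: m_def J_def\<close>)
  obtain \<phi>' where \<phi>': "\<And>x. (\<phi> has_derivative blinfun_apply (\<phi>' x)) (at x)" "continuous_on UNIV \<phi>'"
    using assms(6) unfolding continuously_differentiable_def by blast
  obtain r B where rB: "0 < r" "\<And>\<psi> \<theta>. r \<le> closest_dist P \<psi> \<theta> \<theta>" "\<And>\<psi> \<theta>. closest_dist P \<psi> \<theta> \<theta> \<le> B"
    using closest_dist_same_angle_bounds[of P] assms(1,3) compact_imp_bounded by metis
  have "\<exists>b c. \<forall>v \<omega>. \<phi> (v, \<omega>, \<theta>) = \<phi> (0, 0, \<theta>) + b \<bullet> v + c * (m * (norm v)\<^sup>2 + J * \<omega>\<^sup>2)" for \<theta>
  proof -
    define f where "f z = \<phi> (fst z, snd z, \<theta>)" for z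
    have "(f has_derivative (\<lambda>z. \<phi>' (fst y, snd y, \<theta>) (fst z, snd z, 0))) (at y)" for y
      unfolding f_def[abs_def]
      by (rule has_derivative_compose[OF _ \<phi>'(1)]) (auto intro!: derivative_eq_intros)
    then have "\<forall>y. \<exists>g h. (f has_derivative (\<lambda>z. g \<bullet> fst z + h * snd z)) (at y)"
      using pair_gradient by blast
    then obtain g h where "\<And>y. (f has_derivative (\<lambda>z. g y \<bullet> fst z + h y * snd z)) (at y)"
      unfolding choice_iff by blast
    then interpret collision_invariant m J f g h
      using m J by unfold_locales
    \<comment> \<open>The shift by \<open>pi / 2\<close> cancels the one in \<open>balance\<close>,
      so that the axis parameter points along \<open>\<psi>\<close>.\<close>
    have inv: "invariant_under (closest_dist P (\<psi> + pi / 2) \<theta> \<theta> *\<^sub>R unit_dir \<psi>)" for \<psi>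
      unfolding invariant_under_def f_def
      using balance[of _ "\<psi> + pi / 2" \<theta> \<theta>] by simp
    show ?thesis
      using affine_quadratic_of_directions[OF rB(1) rB(2,3) inv] by (simp add: f_def)
  qed
  then have "\<forall>\<theta>. \<exists>b c. \<forall>v \<omega>. \<phi> (v, \<omega>, \<theta>) = \<phi> (0, 0, \<theta>) + b \<bullet> v + c * (m * (norm v)\<^sup>2 + J * \<omega>\<^sup>2)"
    by blast
  then obtain b c where form:
    "\<And>\<theta> v \<omega>. \<phi> (v, \<omega>, \<theta>) = \<phi> (0, 0, \<theta>) + b \<theta> \<bullet> v + c \<theta> * (m * (norm v)\<^sup>2 + J * \<omega>\<^sup>2)"
    unfolding choice_iff by blast
  \<comment> \<open>The angle \<open>\<theta>\<close> is compared with the reference angle 0.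
    Whatever the distance for these unequal angles, \<open>q\<close> is orthogonal to
    \<open>unit_dir \<psi>\<close>, so without spin the impulse is zero.\<close>
  have exchange: "b \<theta> \<bullet> unit_dir \<psi> + c \<theta> * m = b 0 \<bullet> unit_dir \<psi> + c 0 * m" for \<theta> \<psi>
  proof -
    define q where "q = closest_dist P \<psi> \<theta> 0 *\<^sub>R unit_dir (\<psi> - pi / 2)"
    have "impulse m J q (unit_dir \<psi> - 0) (0 + 0) = 0"
      by (simp add: impulse_def q_def inner_real2 unit_dir_def cos_diff sin_diff)
    from balance[OF q_def this[symmetric]] show ?thesis
      using form[of "unit_dir \<psi>" 0 \<theta>] form[of "unit_dir \<psi>" 0 0] by (simp add: norm_unit_dir)
  qed
  \<comment> \<open>The opposite directions \<open>0\<close> and \<open>pi\<close> separate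
    \<open>c\<close> from the first component of \<open>b\<close>; \<open>pi / 2\<close> gives the
    second.\<close>
  have ends: "b \<theta> $ 1 + c \<theta> * m = b 0 $ 1 + c 0 * m" "- b \<theta> $ 1 + c \<theta> * m = - b 0 $ 1 + c 0 * m"
    "b \<theta> $ 2 + c \<theta> * m = b 0 $ 2 + c 0 * m" for \<theta>
    using exchange[of \<theta> 0] exchange[of \<theta> pi] exchange[of \<theta> "pi / 2"]
    by (simp_all add: inner_real2 unit_dir_def)
  have "c \<theta> * m = c 0 * m" for \<theta> using ends[of \<theta>] by linarith
  then have c: "c \<theta> = c 0" for \<theta> using m by simp
  have b: "b \<theta> = b 0" for \<theta>
    using ends[of \<theta>] c[of \<theta>] by (simp add: vec_eq_iff forall_2)
  \<comment> \<open>The function \<open>a\<close> is \<open>\<phi>\<close> at zero velocity and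
    spin; its derivative is that of \<open>\<phi>\<close> composed with the embedding
    \<open>\<iota>\<close> of the angle.\<close>
  have "continuously_differentiable (\<lambda>\<theta>. \<phi> (0, 0, \<theta>))"
    unfolding continuously_differentiable_def
  proof (intro exI conjI allI)
    define \<iota> :: "real \<Rightarrow>\<^sub>L ((real^2) \<times> real \<times> real)" where "\<iota> = Blinfun (\<lambda>t. (0, 0, t))"
    have \<iota>: "blinfun_apply \<iota> = (\<lambda>t. (0, 0, t))"
      unfolding \<iota>_def by (rule bounded_linear_Blinfun_apply) (intro bounded_linear_intros)
    show "((\<lambda>\<theta>. \<phi> (0, 0, \<theta>)) has_derivative blinfun_apply (\<phi>' (0, 0, \<theta>) o\<^sub>L \<iota>)) (at \<theta>)" for \<theta>
    proof -
      have "((\<lambda>\<theta>. (0, 0, \<theta>)) has_derivative (\<lambda>t. (0, 0, t))) (at \<theta>)"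
        by (auto intro!: derivative_eq_intros)
      from has_derivative_compose[OF this \<phi>'(1)] show ?thesis
        by (simp add: \<iota> blinfun_compose.rep_eq o_def)
    qed
    show "continuous_on UNIV (\<lambda>\<theta>. \<phi>' (0, 0, \<theta>) o\<^sub>L \<iota>)"
      by (intro continuous_intros continuous_on_compose2[OF \<phi>'(2)]) auto
  qed
  moreover have "\<phi> (v, \<omega>, \<theta>) = \<phi> (0, 0, \<theta>) + b 0 \<bullet> v + c 0 * (mass P * (norm v)\<^sup>2 + inertia P * \<omega>\<^sup>2)"
    for v \<omega> \<theta>
    using form[of v \<omega> \<theta>] b[of \<theta>] c[of \<theta>] by (simp add: m_def J_def)
  ultimately show ?thesis using assms(7) by blast
qed

end
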